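(* For a fixed prime $p$, $$\lim_{\sum_{i=1}^{s}b_i\to\infty}\ \sup_{m,n'}\,f(p,s,m,n',{\boldsymbol b})=0.$$
   Context: $s,m$ range over positive integers, $n'$ over nonnegative integers, and ${\boldsymbol b}=(b_1,\dots,b_s)$ over integer vectors with $m=b_0\ge b_1\ge\cdots\ge b_s\ge0$. $[p,0]=1$ and $[p,\ell]=\prod_{j=1}^{\ell}(1-p^{-j})$ for $\ell\ge1$. With $b_0=m$, $$f(p,s,m,n',{\boldsymbol b})=p^{-\sum_{i=1}^{s}(n'+b_i)b_i}\cdot\frac{[p,n'+m][p,m]}{[p,n'+b_s][p,b_s]\prod_{i=1}^{s}[p,b_{i-1}-b_i]}.$$ Here $s$ is free (not fixed): the limit means that for every $\varepsilon>0$ there is $N$ such that $\sup_{m\ge b_1,\,n'\ge0}f(p,s,m,n',{\boldsymbol b})<\varepsilon$ for all $s$ and all ${\boldsymbol b}=(b_1,\dots,b_s)$ with $\sum_{i=1}^{s}b_i\ge N$. *)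

theory Defs
  imports "HOL-Analysis.Analysis" "HOL-Computational_Algebra.Primes"
begin

definition pbr :: "nat \<Rightarrow> nat \<Rightarrow> real" where
  "pbr p l = (\<Prod>j=1..l. 1 - real p powi (- int j))"

(* A vector (b_1, ..., b_s) of nonnegative integers is the restriction of b :: nat => nat to {1..s}.
   Values of b outside {1..s} are never used: the update b(0 := m) implements b_0 = m.
   The truncated subtraction below is the ordinary one whenever m >= b_1 >= ... >= b_s. *)
definition f :: "nat \<Rightarrow> nat \<Rightarrow> nat \<Rightarrow> nat \<Rightarrow> (nat \<Rightarrow> nat) \<Rightarrow> real" where
  "f p s m n' b =
     real p powi (- int (\<Sum>i=1..s. (n' + b i) * b i)) *
     ((pbr p (n' + m) * pbr p m) /
      (pbr p (n' + b s) * pbr p (b s) *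
       (\<Prod>i=1..s. pbr p ((b(0 := m)) (i - 1) - (b(0 := m)) i))))"

(* The supremum is taken in the extended reals, so that a bound on it includes
   the boundedness of the family; a real-valued SUP would be unspecified on unbounded sets. *)
definition sup_f :: "nat \<Rightarrow> nat \<Rightarrow> (nat \<Rightarrow> nat) \<Rightarrow> ereal" where
  "sup_f p s b = (SUP (m, n') \<in> {m. m \<ge> 1 \<and> m \<ge> b 1} \<times> UNIV. ereal (f p s m n' b))"

end

theory Submission
  imports Defs
begin

text \<open>
  The estimate behind the limit is \<open>f p s m n' b \<le> 2 / 2 ^ (b\<^sub>1 + \<dots> + b\<^sub>s)\<close>, uniformly in
  \<open>m \<ge> b\<^sub>1\<close>, \<open>n'\<close>, \<open>s\<close> and the prime.

  Since \<open>l \<mapsto> [p,l]\<close> is decreasing, \<open>[p,n'+m]\<close> is absorbed by \<open>[p,n'+b\<^sub>s]\<close>, and \<open>[p,m]\<close> by the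
  first gap factor \<open>[p,m-b\<^sub>1]\<close>, so that neither \<open>m\<close> nor \<open>n'\<close> survives in the quotient. What
  remains in the denominator is \<open>[p,b\<^sub>s]\<close> times the gap factors with \<open>i \<ge> 2\<close>. The arguments of
  these brackets add up to \<open>b\<^sub>1\<close> by telescoping (\<open>telescope_gaps\<close>), and every factor
  \<open>1 - p\<^sup>-\<^sup>j\<close> is at least \<open>1/2\<close>, so this denominator is at least \<open>2\<^sup>-\<^sup>b\<close> with \<open>b = b\<^sub>1\<close>,
  however large \<open>s\<close> may be (\<open>denominator_ge\<close>).

  The power of \<open>p\<close> in front is at most \<open>2\<close> to the power \<open>-(b\<^sub>1\<^sup>2 + \<dots> + b\<^sub>s\<^sup>2)\<close>. The loss of
  \<open>b\<^sub>1\<close> in the exponent is paid for by the single square \<open>b\<^sub>1\<^sup>2 \<ge> 2b\<^sub>1 - 1\<close>, the other squares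
  dominate their roots, and the total exponent is at most \<open>1 - (b\<^sub>1 + \<dots> + b\<^sub>s)\<close>.
\<close>

lemma pbr_Suc: "pbr p (Suc l) = pbr p l * (1 - real p powi (- int (Suc l)))"
  by (simp add: pbr_def)

lemma pbr_factor_bounds:
  assumes "p \<ge> 2"
  shows "1/2 \<le> 1 - real p powi (- int (Suc l))" "1 - real p powi (- int (Suc l)) \<le> 1"
proof -
  have "(2::real) \<le> real p ^ Suc l"
    using assms self_le_power[of "real p" "Suc l"] by linarith
  hence "inverse (real p ^ Suc l) \<le> inverse 2"
    by (rule le_imp_inverse_le) simp
  thus "1/2 \<le> 1 - real p powi (- int (Suc l))"
    by (simp only: power_int_minus power_int_of_nat) simp
qed simp

lemma pbr_ge_half_power:
  assumes "p \<ge> 2"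
  shows "(1/2) ^ l \<le> pbr p l"
proof (induction l)
  case 0
  show ?case by (simp add: pbr_def)
next
  case (Suc l)
  have "(1/2) ^ l * (1/2) \<le> pbr p l * (1 - real p powi (- int (Suc l)))"
    using Suc pbr_factor_bounds(1)[OF assms, of l] order_trans[OF _ Suc, of 0]
    by (intro mult_mono) auto
  thus ?case by (simp add: pbr_Suc mult.commute)
qed

lemma pbr_pos:
  assumes "p \<ge> 2"
  shows "pbr p l > 0"
  using pbr_ge_half_power[OF assms, of l] by (rule less_le_trans[rotated]) simp

lemma pbr_antimono:
  assumes "p \<ge> 2" "k \<le> l"
  shows "pbr p l \<le> pbr p k"
proof -
  have "antimono (pbr p)"
    unfolding decseq_Suc_iff pbr_Suc
    by (intro allI mult_left_le pbr_factor_bounds(2) less_imp_le[OF pbr_pos] assms(1))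
  thus ?thesis using assms(2) by (rule antimonoD)
qed

lemma telescope_gaps:
  fixes b :: "nat \<Rightarrow> nat"
  assumes "s \<ge> 1" "antimono_on {1..s} b"
  shows "b s + (\<Sum>i=2..s. b (i - 1) - b i) = b 1"
  using assms
proof (induction s rule: nat_induct_at_least)
  case base
  show ?case by simp
next
  case (Suc s)
  have "antimono_on {1..s} b"
    using Suc.prems by (rule monotone_on_subset) auto
  hence IH: "b s + (\<Sum>i=2..s. b (i - 1) - b i) = b 1"
    by (rule Suc.IH)
  have "b (Suc s) \<le> b s"
    using monotone_onD[OF Suc.prems, of s "Suc s"] Suc.hyps by simp
  thus ?case using IH Suc.hyps by simp
qed

text \<open>
  Bounding each bracket below by one constant less than \<open>1\<close> would lose a factor for every \<open>i\<close>.
  The bound \<open>[p,l] \<ge> 2\<^sup>-\<^sup>l\<close> loses nothing where \<open>b\<close> does not jump, and its exponents telescope.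
\<close>
lemma denominator_ge:
  fixes b :: "nat \<Rightarrow> nat"
  assumes "p \<ge> 2" "s \<ge> 1" "antimono_on {1..s} b"
  shows "pbr p (m - b 1) * (1/2) ^ b 1
           \<le> pbr p (b s) * (\<Prod>i=1..s. pbr p ((b(0 := m)) (i - 1) - (b(0 := m)) i))"
proof -
  have "(1/2) ^ b 1 = (1/2) ^ b s * (\<Prod>i=2..s. (1/2::real) ^ (b (i - 1) - b i))"
    unfolding telescope_gaps[OF assms(2,3), symmetric] by (simp add: power_add power_sum)
  also have "\<dots> \<le> pbr p (b s) * (\<Prod>i=2..s. pbr p (b (i - 1) - b i))"
    using pbr_pos[OF assms(1)] pbr_ge_half_power[OF assms(1)]
    by (intro mult_mono prod_mono prod_nonneg) (auto intro: less_imp_le)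
  finally have tail: "(1/2) ^ b 1 \<le> pbr p (b s) * (\<Prod>i=2..s. pbr p (b (i - 1) - b i))" .
  have "(\<Prod>i=1..s. pbr p ((b(0 := m)) (i - 1) - (b(0 := m)) i))
          = pbr p (m - b 1) * (\<Prod>i=2..s. pbr p ((b(0 := m)) (i - 1) - (b(0 := m)) i))"
    using assms(2) by (subst prod.atLeast_Suc_atMost) (auto simp: numeral_2_eq_2)
  also have "(\<Prod>i=2..s. pbr p ((b(0 := m)) (i - 1) - (b(0 := m)) i))
          = (\<Prod>i=2..s. pbr p (b (i - 1) - b i))"
    by (rule prod.cong) auto
  finally show ?thesis
    using mult_left_mono[OF tail less_imp_le[OF pbr_pos[OF assms(1), of "m - b 1"]]]
    by (simp add: mult_ac)
qed

lemma bracket_quotient_le: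
  fixes b :: "nat \<Rightarrow> nat"
  assumes "p \<ge> 2" "s \<ge> 1" "antimono_on {1..s} b" "b 1 \<le> m"
  shows "pbr p (n' + m) * pbr p m /
           (pbr p (n' + b s) * pbr p (b s) *
            (\<Prod>i=1..s. pbr p ((b(0 := m)) (i - 1) - (b(0 := m)) i))) \<le> 2 ^ b 1"
    (is "_ / (_ * _ * ?G) \<le> _")
proof -
  note pos = pbr_pos[OF assms(1)]
  have "b s \<le> b 1"
    using monotone_onD[OF assms(3), of 1 s] assms(2) by simp
  hence "pbr p (n' + m) \<le> pbr p (n' + b s)"
    using assms(1,4) by (intro pbr_antimono) auto
  moreover have "pbr p m \<le> 2 ^ b 1 * (pbr p (b s) * ?G)"
  proof -
    have "pbr p m \<le> pbr p (m - b 1)"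
      using assms(1) by (intro pbr_antimono) auto
    also have "\<dots> = 2 ^ b 1 * (pbr p (m - b 1) * (1/2) ^ b 1)"
      by (simp add: power_divide)
    also have "\<dots> \<le> 2 ^ b 1 * (pbr p (b s) * ?G)"
      by (intro mult_left_mono denominator_ge assms) auto
    finally show ?thesis .
  qed
  ultimately have "pbr p (n' + m) * pbr p m \<le> pbr p (n' + b s) * (2 ^ b 1 * (pbr p (b s) * ?G))"
    using pos by (intro mult_mono) (auto intro: less_imp_le)
  moreover have "pbr p (n' + b s) * pbr p (b s) * ?G > 0"
    using pos by (intro mult_pos_pos prod_pos) auto
  ultimately show ?thesis
    by (simp add: pos_divide_le_eq mult_ac)
qed

lemma sum_plus_first_le_sum_squares:
  fixes b :: "nat \<Rightarrow> nat"
  assumes "s \<ge> 1"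
  shows "(\<Sum>i=1..s. b i) + b 1 \<le> (\<Sum>i=1..s. b i * b i) + 1"
proof -
  have "(\<Sum>i=Suc 1..s. b i) \<le> (\<Sum>i=Suc 1..s. b i * b i)"
    by (intro sum_mono) simp
  moreover have "2 * b 1 \<le> b 1 * b 1 + 1"
    by (cases "b 1") auto
  ultimately show ?thesis
    using assms by (simp add: sum.atLeast_Suc_atMost)
qed

lemma f_le:
  assumes "p \<ge> 2" "s \<ge> 1" "antimono_on {1..s} b" "b 1 \<le> m"
  shows "f p s m n' b \<le> 2 / 2 ^ (\<Sum>i=1..s. b i)"
proof -
  define S where "S = (\<Sum>i=1..s. b i)"
  define E where "E = (\<Sum>i=1..s. (n' + b i) * b i)"
  have "(\<Sum>i=1..s. b i * b i) \<le> E"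
    unfolding E_def by (intro sum_mono) simp
  hence exponent: "S + b 1 \<le> E + 1"
    using sum_plus_first_le_sum_squares[OF assms(2), of b] by (simp add: S_def)
  have "f p s m n' b \<le> real p powi (- int E) * 2 ^ b 1"
    unfolding f_def E_def[symmetric]
    by (intro mult_left_mono bracket_quotient_le assms) simp
  also have "real p powi (- int E) * 2 ^ b 1 \<le> 2 ^ b 1 / 2 ^ E"
    using power_mono[of 2 "real p" E] assms(1)
    by (simp add: power_int_minus field_simps)
  also have "\<dots> \<le> 2 / 2 ^ S"
    using power_increasing[OF exponent, of "2::real"]
    by (simp add: field_simps power_add)
  finally show ?thesis unfolding S_def .
qed

theorem theorem5p9:
  fixes p :: nat
  assumes "prime p"
  shows "\<forall>\<epsilon>>0. \<exists>N::nat. \<forall>s\<ge>1. \<forall>b :: nat \<Rightarrow> nat.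
           antimono_on {1..s} b \<longrightarrow> (\<Sum>i=1..s. b i) \<ge> N \<longrightarrow> sup_f p s b < ereal \<epsilon>"
proof (intro allI impI)
  fix \<epsilon> :: real
  assume "\<epsilon> > 0"
  then obtain N where N: "(1/2) ^ N < \<epsilon> / 2"
    using real_arch_pow_inv[of "\<epsilon> / 2" "1/2"] by auto
  have "sup_f p s b < ereal \<epsilon>"
    if "s \<ge> 1" "antimono_on {1..s} b" "(\<Sum>i=1..s. b i) \<ge> N" for s b
  proof -
    have "2 / 2 ^ (\<Sum>i=1..s. b i) \<le> 2 / (2::real) ^ N"
      using that(3) by (intro divide_left_mono power_increasing) auto
    hence "f p s m n' b \<le> 2 / 2 ^ N" if "b 1 \<le> m" for m n'
      using f_le[OF prime_ge_2_nat[OF assms] \<open>s \<ge> 1\<close> \<open>antimono_on {1..s} b\<close> that]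
      by (rule order_trans[rotated])
    hence "sup_f p s b \<le> ereal (2 / 2 ^ N)"
      unfolding sup_f_def by (intro SUP_least) auto
    also have "\<dots> < ereal \<epsilon>"
      using N by (simp add: power_divide)
    finally show ?thesis .
  qed
  thus "\<exists>N. \<forall>s\<ge>1. \<forall>b. antimono_on {1..s} b \<longrightarrow> (\<Sum>i=1..s. b i) \<ge> N \<longrightarrow> sup_f p s b < ereal \<epsilon>"
    by blast
qed

end
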